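(* Let $m,n\ge2$ be two integers, $d=\gcd(m,n)$ and $d_2=\gcd(2,n)$. Then $$[\mathbb{D}_n^z]\circledcirc[\mathbb{D}_m\oplus\mathbb{Z}_2^c]=\begin{cases}\{[\mathbb{1}],[\mathbb{Z}_{d_2}],[\mathbb{Z}_d],[\mathbb{Z}_2^-],[\mathbb{D}_{d_2}^z],[\mathbb{D}_d^z]\}&\text{if } m\text{ is even},\\ \{[\mathbb{1}],[\mathbb{Z}_{d_2}],[\mathbb{Z}_d],[\mathbb{Z}_2^-],[\mathbb{D}_d^z]\}&\text{if } m\text{ is odd}.\end{cases}$$
   Context: $[K]$ is the conjugacy class of a subgroup $K$ in $\mathrm{O}(3)$, and the clips operation is $[H_1]\circledcirc[H_2]=\{[H_1\cap gH_2g^{-1}]:g\in\mathrm{O}(3)\}$. $(e_1,e_2,e_3)$ is the canonical basis of $\mathbb{R}^3$, $\mathbf{r}(n,\theta)$ is the rotation by angle $\theta$ about the axis directed by $n\neq0$. $\mathbb{1}=\{\mathrm{Id}\}$; $\mathbb{Z}_2^c=\{\pm\mathrm{Id}\}$; $H\oplus\mathbb{Z}_2^c=H\cup(-H)$ for $H\subset\mathrm{SO}(3)$; $\mathbb{Z}_k=\{\mathbf{r}(e_3,2j\pi/k):0\le j\le k-1\}$; $\mathbb{D}_k=\langle\mathbf{r}(e_3,2\pi/k),\mathbf{r}(e_1,\pi)\rangle$ for $k\ge2$; $\mathbb{Z}_2^-=\{\mathrm{Id},-\mathbf{r}(e_3,\pi)\}$; $\mathbb{D}_k^z=\mathbb{Z}_k\cup(-\mathbf{r}(e_1,\pi))\mathbb{Z}_k$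 for $k\ge2$. Conventions: $[\mathbb{Z}_1]=[\mathbb{1}]$, $[\mathbb{D}_1^z]=[\mathbb{Z}_2^-]$. *)

theory Defs
  imports "HOL-Analysis.Analysis" "HOL-Algebra.Algebra"
begin

definition O3 :: "(real^3^3) monoid" where
  "O3 = \<lparr>carrier = {A. orthogonal_matrix A}, mult = (**), one = mat 1\<rparr>"

lemma O3_simps:
  "carrier O3 = {A. orthogonal_matrix A}" "A \<otimes>\<^bsub>O3\<^esub> B = A ** B" "\<one>\<^bsub>O3\<^esub> = mat 1"
  by (auto simp: O3_def)

lemma group_O3: "group O3"
proof (rule groupI)
  fix A assume "A \<in> carrier O3"
  then show "\<exists>B\<in>carrier O3. B \<otimes>\<^bsub>O3\<^esub> A = \<one>\<^bsub>O3\<^esub>"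
    by (intro bexI[of _ "Finite_Cartesian_Product.transpose A"])
      (auto simp: O3_simps orthogonal_matrix_def)
qed (auto simp: O3_simps orthogonal_matrix_mul orthogonal_matrix_id matrix_mul_assoc)

definition conj_set :: "real^3^3 \<Rightarrow> (real^3^3) set \<Rightarrow> (real^3^3) set" where
  "conj_set g K = (\<lambda>k. g \<otimes>\<^bsub>O3\<^esub> k \<otimes>\<^bsub>O3\<^esub> inv\<^bsub>O3\<^esub> g) ` K"

definition conj_class :: "(real^3^3) set \<Rightarrow> (real^3^3) set set" where
  "conj_class K = {conj_set g K | g. g \<in> carrier O3}"

(* An operation on conjugacy classes; clips_conj_class below evaluates it on any
   pair of representatives. *)
definition clips :: "(real^3^3) set set \<Rightarrow> (real^3^3) set set \<Rightarrow> (real^3^3) set set set" where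
  "clips C1 C2 =
     {conj_class (H1 \<inter> conj_set g H2) | H1 H2 g. H1 \<in> C1 \<and> H2 \<in> C2 \<and> g \<in> carrier O3}"

lemma conj_set_conj_set:
  assumes "g \<in> carrier O3" "h \<in> carrier O3" "K \<subseteq> carrier O3"
  shows "conj_set g (conj_set h K) = conj_set (g \<otimes>\<^bsub>O3\<^esub> h) K"
proof -
  interpret group O3 by (rule group_O3)
  have "g \<otimes>\<^bsub>O3\<^esub> (h \<otimes>\<^bsub>O3\<^esub> k \<otimes>\<^bsub>O3\<^esub> inv\<^bsub>O3\<^esub> h) \<otimes>\<^bsub>O3\<^esub> inv\<^bsub>O3\<^esub> g
      = (g \<otimes>\<^bsub>O3\<^esub> h) \<otimes>\<^bsub>O3\<^esub> k \<otimes>\<^bsub>O3\<^esub> inv\<^bsub>O3\<^esub> (g \<otimes>\<^bsub>O3\<^esub> h)" if "k \<in> K" for k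
    using assms that by (simp add: inv_mult_group subset_iff m_assoc)
  then show ?thesis
    unfolding conj_set_def by (force simp: image_image)
qed

lemma conj_set_one:
  assumes "K \<subseteq> carrier O3"
  shows "conj_set \<one>\<^bsub>O3\<^esub> K = K"
proof -
  interpret group O3 by (rule group_O3)
  have "(\<lambda>k. \<one>\<^bsub>O3\<^esub> \<otimes>\<^bsub>O3\<^esub> k \<otimes>\<^bsub>O3\<^esub> inv\<^bsub>O3\<^esub> \<one>\<^bsub>O3\<^esub>) ` K = id ` K"
    by (rule image_cong) (use assms in auto)
  then show ?thesis
    by (simp add: conj_set_def)
qed

lemma conj_set_closed:
  assumes "g \<in> carrier O3" "K \<subseteq> carrier O3"
  shows "conj_set g K \<subseteq> carrier O3"
proof -
  interpret group O3 by (rule group_O3)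
  show ?thesis
    using assms by (auto simp: conj_set_def subset_iff intro!: m_closed)
qed

lemma conj_set_Int:
  assumes "g \<in> carrier O3" "H \<subseteq> carrier O3" "K \<subseteq> carrier O3"
  shows "conj_set g (H \<inter> K) = conj_set g H \<inter> conj_set g K"
proof -
  interpret group O3 by (rule group_O3)
  have "inj_on (\<lambda>k. g \<otimes>\<^bsub>O3\<^esub> k \<otimes>\<^bsub>O3\<^esub> inv\<^bsub>O3\<^esub> g) (carrier O3)"
    using assms by (auto intro!: inj_onI)
  then show ?thesis
    unfolding conj_set_def by (rule inj_on_image_Int) (use assms in auto)
qed

lemma conj_class_conj_set:
  assumes "g \<in> carrier O3" "K \<subseteq> carrier O3"
  shows "conj_class (conj_set g K) = conj_class K"
proof -
  interpret group O3 by (rule group_O3)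
  have "conj_set h K = conj_set (h \<otimes>\<^bsub>O3\<^esub> inv\<^bsub>O3\<^esub> g) (conj_set g K)" if "h \<in> carrier O3" for h
    using assms that by (simp add: conj_set_conj_set m_assoc)
  moreover have "conj_set h (conj_set g K) = conj_set (h \<otimes>\<^bsub>O3\<^esub> g) K" if "h \<in> carrier O3" for h
    using assms that by (simp add: conj_set_conj_set)
  ultimately show ?thesis
    using assms(1) unfolding conj_class_def by (blast intro: m_closed inv_closed)
qed

lemma clips_conj_class:
  assumes "H1 \<subseteq> carrier O3" "H2 \<subseteq> carrier O3"
  shows "clips (conj_class H1) (conj_class H2)
           = {conj_class (H1 \<inter> conj_set g H2) | g. g \<in> carrier O3}" (is "?L = ?R")
proof
  interpret group O3 by (rule group_O3)
  show "?R \<subseteq> ?L"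
  proof
    fix c assume "c \<in> ?R"
    then obtain g where g: "g \<in> carrier O3" "c = conj_class (H1 \<inter> conj_set g H2)" by blast
    have "H1 \<in> conj_class H1" "H2 \<in> conj_class H2"
      using assms[THEN conj_set_one] one_closed unfolding conj_class_def by (blast dest: sym)+
    with g show "c \<in> ?L" unfolding clips_def by blast
  qed
  show "?L \<subseteq> ?R"
  proof
    fix c assume "c \<in> ?L"
    then obtain a b g where abg: "a \<in> carrier O3" "b \<in> carrier O3" "g \<in> carrier O3"
      and c: "c = conj_class (conj_set a H1 \<inter> conj_set g (conj_set b H2))"
      unfolding clips_def conj_class_def by blast
    define k where "k = inv\<^bsub>O3\<^esub> a \<otimes>\<^bsub>O3\<^esub> (g \<otimes>\<^bsub>O3\<^esub> b)"
    have k: "k \<in> carrier O3" using abg by (simp add: k_def)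
    have "a \<otimes>\<^bsub>O3\<^esub> k = g \<otimes>\<^bsub>O3\<^esub> b"
      using abg by (simp add: k_def m_assoc[symmetric])
    then have "conj_set g (conj_set b H2) = conj_set a (conj_set k H2)"
      using abg k assms by (simp add: conj_set_conj_set)
    then have "c = conj_class (conj_set a (H1 \<inter> conj_set k H2))"
      using c abg k assms by (simp add: conj_set_Int conj_set_closed)
    also have "\<dots> = conj_class (H1 \<inter> conj_set k H2)"
      using abg assms by (intro conj_class_conj_set) auto
    finally show "c \<in> ?R" using k by blast
  qed
qed

abbreviation e1 :: "real^3" where "e1 \<equiv> axis 1 1"
abbreviation e3 :: "real^3" where "e3 \<equiv> axis 3 1"

(* Rodrigues' formula; meaningful for n \<noteq> 0. *)
definition rot :: "real^3 \<Rightarrow> real \<Rightarrow> real^3^3" where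
  "rot n \<theta> = (let u = n /\<^sub>R norm n in
     matrix (\<lambda>v. cos \<theta> *\<^sub>R v + sin \<theta> *\<^sub>R cross3 u v + ((1 - cos \<theta>) * (u \<bullet> v)) *\<^sub>R u))"

definition triv :: "(real^3^3) set" where
  "triv = {mat 1}"

definition Z :: "nat \<Rightarrow> (real^3^3) set" where
  "Z k = {rot e3 (2 * real j * pi / real k) | j. j < k}"

definition D :: "nat \<Rightarrow> (real^3^3) set" where
  "D k = generate O3 {rot e3 (2 * pi / real k), rot e1 pi}"

definition Z2_minus :: "(real^3^3) set" where
  "Z2_minus = {mat 1, - rot e3 pi}"

(* The case k = 1 is the convention that the class of Dz 1 is that of Z2_minus. *)
definition Dz :: "nat \<Rightarrow> (real^3^3) set" where
  "Dz k = (if k = 1 then Z2_minus else Z k \<union> ((- rot e1 pi) <#\<^bsub>O3\<^esub> Z k))"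

(* The direct sum of H with {Id, -Id}. *)
definition plus_Z2c :: "(real^3^3) set \<Rightarrow> (real^3^3) set" where
  "plus_Z2c H = H \<union> uminus ` H"

end

theory Submission
  imports Defs
begin

text \<open>
  Both groups consist of signed rotations, and determinants separate the signs.  A rotation of
  \<open>Dz n\<close> lies in \<open>Z n\<close>; an element of determinant \<open>-1\<close> is minus a half-turn about a horizontal
  axis, that is, a reflection in a vertical plane.  As \<open>plus_Z2c (D m)\<close> is stable under negation, such
  a reflection lies in its conjugate by \<open>g\<close> exactly when the half-turn lies in the conjugate of \<open>D m\<close>.

  The intersection is a subgroup of \<open>Dz n\<close>.  If its rotations form \<open>Z k\<close>, it equals \<open>Z k\<close> when it has
  no reflection; otherwise turning one of its reflections to the standard position, by a rotation
  about \<open>e3\<close>, makes it a conjugate of \<open>Dz k\<close> (\<open>conj_class_of_rotations\<close>).  So the class depends only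
  on \<open>k\<close> and on whether there is a reflection.  The axis \<open>g e3\<close> governs \<open>k\<close>:

  \<^item> if \<open>g e3 = \<plusminus>e3\<close>, conjugation by \<open>g\<close> preserves \<open>Z m\<close>, so the rotations are
    \<open>Z n \<inter> Z m = Z (gcd m n)\<close> (\<open>rotations_axis_kept\<close>);
  \<^item> otherwise a common rotation cannot come from \<open>Z m\<close> unless it is trivial, since it would fix both
    \<open>e3\<close> and \<open>g e3\<close>.  If nontrivial, it thus comes from a half-turn of \<open>D m\<close> and has order 2, so \<open>k\<close> is
    1 or 2, the latter only for even \<open>n\<close> (\<open>rotations_axis_moved\<close>).

  In the second case with \<open>k = 2\<close>, a reflection yields two commuting half-turns in the conjugate of
  \<open>D m\<close>, about perpendicular axes.  One of them or their product comes from \<open>Z m\<close>, which has no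
  element of order 2 when \<open>m\<close> is odd (\<open>no_reflection_odd\<close>).  This is why \<open>Dz (gcd 2 n)\<close> needs \<open>m\<close> even.

  Every class that this leaves occurs (\<open>clip_witnesses\<close>, \<open>clip_witness_even\<close>).  Keeping the axis gives
  \<open>k = gcd m n\<close>, exchanging \<open>e1\<close> and \<open>e3\<close> gives \<open>k = gcd 2 n\<close>, and tilting the axis by 45 degrees about
  \<open>e1\<close> gives \<open>k = 1\<close>.  A further rotation about \<open>e3\<close> by a small fraction of \<open>pi\<close> removes the reflections.
\<close>

section \<open>Rotations about the vertical axis and the half-turn about the first axis\<close>

abbreviation rz :: "real \<Rightarrow> real^3^3" where "rz \<equiv> rot e3"
abbreviation hx :: "real^3^3" where "hx \<equiv> rot e1 pi"
abbreviation tr :: "real^3^3 \<Rightarrow> real^3^3" where "tr \<equiv> Finite_Cartesian_Product.transpose"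

lemmas mat3_eq_iff = vec_eq_iff forall_3
lemmas mat3_mult = matrix_matrix_mult_def sum_3

lemma axis_entries: "axis i x $ j = (if j = i then x else (0 :: real))"
  by (simp add: axis_def)

lemma rz_entries:
  "rz a $ 1 $ 1 = cos a" "rz a $ 1 $ 2 = - sin a" "rz a $ 1 $ 3 = 0"
  "rz a $ 2 $ 1 = sin a" "rz a $ 2 $ 2 = cos a" "rz a $ 2 $ 3 = 0"
  "rz a $ 3 $ 1 = 0" "rz a $ 3 $ 2 = 0" "rz a $ 3 $ 3 = 1"
  by (simp_all add: rot_def Let_def matrix_def cross3_def norm_axis_1 inner_axis axis_entries)

lemma hx_entries:
  "hx $ 1 $ 1 = 1" "hx $ 1 $ 2 = 0" "hx $ 1 $ 3 = 0"
  "hx $ 2 $ 1 = 0" "hx $ 2 $ 2 = -1" "hx $ 2 $ 3 = 0"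
  "hx $ 3 $ 1 = 0" "hx $ 3 $ 2 = 0" "hx $ 3 $ 3 = -1"
  by (simp_all add: rot_def Let_def matrix_def cross3_def norm_axis_1 inner_axis axis_entries)

lemma mat1_entries:
  "(mat 1 :: real^3^3) $ i $ j = (if i = j then 1 else 0)"
  by (simp add: mat_def)

lemma rz_add: "rz a ** rz b = rz (a + b)"
  by (simp add: mat3_eq_iff mat3_mult rz_entries cos_add sin_add)

lemma rz_0: "rz 0 = mat 1"
  by (simp add: mat3_eq_iff rz_entries mat1_entries)

lemma hx_hx: "hx ** hx = mat 1"
  by (simp add: mat3_eq_iff mat3_mult hx_entries mat1_entries)

lemma rz_hx: "rz a ** hx = hx ** rz (- a)"
  by (simp add: mat3_eq_iff mat3_mult hx_entries rz_entries)

lemma flip_flip: "(hx ** rz a) ** (hx ** rz a) = mat 1"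
proof -
  have "(hx ** rz a) ** (hx ** rz a) = hx ** (rz a ** hx) ** rz a"
    by (simp add: matrix_mul_assoc)
  then show ?thesis by (simp add: rz_hx matrix_mul_assoc hx_hx) (simp add: rz_add rz_0)
qed

lemma tr_rz: "tr (rz a) = rz (- a)"
  by (simp add: mat3_eq_iff Finite_Cartesian_Product.transpose_def rz_entries)

lemma orthogonal_rz: "orthogonal_matrix (rz a)"
  by (simp add: orthogonal_matrix tr_rz rz_add rz_0)

lemma orthogonal_hx: "orthogonal_matrix hx"
  by (simp add: orthogonal_matrix mat3_eq_iff mat3_mult Finite_Cartesian_Product.transpose_def hx_entries mat1_entries)

lemma det_rz: "det (rz a) = 1"
  by (simp add: det_3 rz_entries flip: power2_eq_square)

lemma det_hx: "det hx = 1"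
  by (simp add: det_3 hx_entries)

lemma det_uminus_3: "det (- A) = - det (A :: real^3^3)"
  by (simp add: det_3)

lemma uminus_mult: "(- A) ** B = - (A ** (B :: real^3^3))"
  by (simp add: mat3_eq_iff mat3_mult)

lemma mult_uminus: "A ** (- B) = - (A ** (B :: real^3^3))"
  by (simp add: mat3_eq_iff mat3_mult)

lemma tr_uminus: "tr (- A) = - tr A"
  by (simp add: vec_eq_iff Finite_Cartesian_Product.transpose_def)

lemma orthogonal_uminus: "orthogonal_matrix A \<Longrightarrow> orthogonal_matrix (- A :: real^3^3)"
  by (simp add: orthogonal_matrix tr_uminus uminus_mult mult_uminus)

lemma hx_cancel: "hx ** (hx ** A) = A"
  by (simp add: matrix_mul_assoc hx_hx)

lemma rz_eq_iff: "rz a = rz b \<longleftrightarrow> (\<exists>k::int. a = b + 2 * pi * k)"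
proof -
  have "rz a = rz b \<longleftrightarrow> sin a = sin b \<and> cos a = cos b"
    by (auto simp: mat3_eq_iff rz_entries)
  then show ?thesis by (simp add: sin_cos_eq_iff mult.commute mult.left_commute)
qed

lemma rz_cos_cases:
  assumes "cos a = cos b" shows "rz a = rz b \<or> rz a = rz (- b)"
proof -
  have "sin a ^ 2 = sin b ^ 2" using assms by (simp add: sin_squared_eq)
  then have "sin a = sin b \<or> sin a = - sin b" by (simp add: power2_eq_iff)
  then show ?thesis using assms by (auto simp: mat3_eq_iff rz_entries)
qed

section \<open>Cyclic and dihedral groups\<close>

text \<open>Membership in \<open>Z k\<close> as divisibility of the angle, insensitive to the choice of the angle
  modulo \<open>2 * pi\<close>.  All later questions about angles become questions about integers through it.\<close>

lemma rz_in_Z_iff: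
  assumes "k \<ge> 1"
  shows "rz a \<in> Z k \<longleftrightarrow> (\<exists>i::int. a * k = 2 * pi * i)"
proof
  assume "rz a \<in> Z k"
  then obtain j where "rz a = rz (2 * real j * pi / real k)" by (auto simp: Z_def)
  then obtain l :: int where "a = 2 * real j * pi / real k + 2 * pi * l"
    by (auto simp: rz_eq_iff)
  then have "a * k = 2 * pi * of_int (int j + l * int k)"
    using assms by (simp add: field_simps)
  then show "\<exists>i::int. a * k = 2 * pi * i" by blast
next
  assume "\<exists>i::int. a * k = 2 * pi * i"
  then obtain i :: int where i: "a * k = 2 * pi * i" by blast
  define j where "j = nat (i mod int k)"
  have j: "j < k" "i = int j + (i div int k) * int k"
    using assms by (auto simp: j_def nat_less_iff)
  have "real_of_int i = of_int (int j + (i div int k) * int k)" using j(2) by simp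
  then have "a * k = (2 * real j * pi / real k + 2 * pi * (i div int k)) * k"
    using assms i by (simp add: field_simps)
  then have "a = 2 * real j * pi / real k + 2 * pi * (i div int k)" using assms by simp
  then have "rz a = rz (2 * real j * pi / real k)" by (auto simp: rz_eq_iff)
  with j(1) show "rz a \<in> Z k" by (auto simp: Z_def)
qed

lemma Z_E: assumes "A \<in> Z k" obtains a where "A = rz a"
  using assms by (auto simp: Z_def)

lemma Z_one: "k \<ge> 1 \<Longrightarrow> mat 1 \<in> Z k"
  by (simp add: rz_in_Z_iff flip: rz_0)

lemma Z_mult:
  assumes "k \<ge> 1" "A \<in> Z k" "B \<in> Z k" shows "A ** B \<in> Z k"
proof -
  obtain a b where ab: "A = rz a" "B = rz b" using assms by (metis Z_E)
  then obtain i j :: int where "a * k = 2 * pi * i" "b * k = 2 * pi * j"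
    using assms by (auto simp: rz_in_Z_iff)
  then have "(a + b) * k = 2 * pi * of_int (i + j)" by (simp add: algebra_simps)
  then show ?thesis unfolding ab rz_add rz_in_Z_iff[OF assms(1)] by blast
qed

lemma Z_uminus:
  assumes "k \<ge> 1" "rz a \<in> Z k" shows "rz (- a) \<in> Z k"
proof -
  obtain i :: int where "a * k = 2 * pi * i" using assms by (auto simp: rz_in_Z_iff)
  then have "(- a) * k = 2 * pi * of_int (- i)" by simp
  then show ?thesis unfolding rz_in_Z_iff[OF assms(1)] by blast
qed

text \<open>With \<open>rz_hx\<close>, this turns products in the dihedral groups into products in \<open>Z k\<close>: a half-turn
  can be moved across a rotation at the price of conjugating it.\<close>

lemma Z_hx_conj:
  assumes "k \<ge> 1" "A \<in> Z k" shows "hx ** (A ** hx) \<in> Z k"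
  using assms by (metis Z_E Z_uminus rz_hx hx_cancel)

text \<open>Bezout: an angle that is a multiple of both \<open>2 * pi / m\<close> and \<open>2 * pi / n\<close> is one of
  \<open>2 * pi / gcd m n\<close>.\<close>

lemma Z_Int_Z:
  assumes "m \<ge> 1" "n \<ge> 1" shows "Z m \<inter> Z n = Z (gcd m n)"
proof -
  have d: "gcd m n \<ge> 1" using assms by (simp add: Suc_le_eq)
  have "rz a \<in> Z m \<and> rz a \<in> Z n \<longleftrightarrow> rz a \<in> Z (gcd m n)" for a
  proof
    assume "rz a \<in> Z m \<and> rz a \<in> Z n"
    then obtain i j :: int where ij: "a * m = 2 * pi * i" "a * n = 2 * pi * j"
      using assms by (auto simp: rz_in_Z_iff)
    obtain u v :: int where uv: "u * int m + v * int n = gcd (int m) (int n)"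
      using bezout_int by blast
    have "a * gcd m n = a * of_int (u * int m + v * int n)"
      unfolding uv by simp
    also have "\<dots> = u * (a * m) + v * (a * n)" by (simp add: algebra_simps)
    also have "\<dots> = 2 * pi * of_int (u * i + v * j)" unfolding ij by (simp add: algebra_simps)
    finally show "rz a \<in> Z (gcd m n)" unfolding rz_in_Z_iff[OF d] by blast
  next
    assume "rz a \<in> Z (gcd m n)"
    then obtain i :: int where i: "a * gcd m n = 2 * pi * i" by (auto simp: rz_in_Z_iff[OF d])
    have "rz a \<in> Z q" if q: "q \<ge> 1" "gcd m n dvd q" for q
    proof -
      obtain c where "q = gcd m n * c" using q(2) by blast
      then have "a * q = (a * gcd m n) * c" by simp
      also have "\<dots> = 2 * pi * of_int (i * int c)" unfolding i by simp
      finally show ?thesis unfolding rz_in_Z_iff[OF q(1)] by blast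
    qed
    then show "rz a \<in> Z m \<and> rz a \<in> Z n" using assms by simp
  qed
  then show ?thesis by (blast elim: Z_E)
qed

lemma Z_1: "Z 1 = triv"
  by (simp add: Z_def triv_def rz_0)

lemma Z_2: "Z 2 = {mat 1, rz pi}"
proof -
  have "Z 2 = (\<lambda>j. rz (2 * real j * pi / real 2)) ` {..<2}" by (auto simp: Z_def)
  then show ?thesis by (simp add: lessThan_nat_numeral lessThan_Suc rz_0 insert_commute)
qed

lemma rz_pi_in_Z_iff:
  assumes "k \<ge> 1" shows "rz pi \<in> Z k \<longleftrightarrow> even k"
proof -
  have "pi * k = 2 * pi * of_int i \<longleftrightarrow> int k = 2 * i" for i :: int
  proof -
    have "pi * k = 2 * pi * of_int i \<longleftrightarrow> real k = 2 * of_int i" by simp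
    also have "\<dots> \<longleftrightarrow> real_of_int (int k) = of_int (2 * i)" by simp
    finally show ?thesis using of_int_eq_iff by blast
  qed
  then have "rz pi \<in> Z k \<longleftrightarrow> even (int k)" unfolding rz_in_Z_iff[OF assms] by (metis evenE dvd_triv_left)
  then show ?thesis by simp
qed

lemma rz_square_one:
  assumes "rz a ** rz a = mat 1" shows "rz a = mat 1 \<or> rz a = rz pi"
proof -
  have "rz (a + a) = rz 0" using assms by (simp add: rz_add rz_0)
  then obtain k :: int where k: "a = pi * k" by (auto simp: rz_eq_iff)
  show ?thesis
  proof (cases "even k")
    case True
    then obtain l where "k = 2 * l" by blast
    with k have "rz a = rz 0" by (auto simp: rz_eq_iff)
    then show ?thesis by (simp add: rz_0)
  next
    case False
    then obtain l where "k = 2 * l + 1" by (blast elim: oddE)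
    with k have "a = pi + 2 * pi * l" by (simp add: algebra_simps)
    then show ?thesis unfolding rz_eq_iff by blast
  qed
qed

lemma D_mult:
  assumes "A \<in> D m" "B \<in> D m" shows "A ** B \<in> D m"
  using generate.eng[of A O3 _ B] assms by (simp add: D_def O3_simps)

lemma D_iff:
  assumes "m \<ge> 1"
  shows "A \<in> D m \<longleftrightarrow> A \<in> Z m \<or> hx ** A \<in> Z m"
proof
  interpret group O3 by (rule group_O3)
  let ?r = "rz (2 * pi / real m)"
  have inv_gens: "inv\<^bsub>O3\<^esub> ?r = rz (- (2 * pi / real m))" "inv\<^bsub>O3\<^esub> hx = hx"
    by (rule inv_equality; simp add: O3_simps orthogonal_rz orthogonal_hx rz_add rz_0 hx_hx)+
  have r: "?r \<in> Z m" "rz (- (2 * pi / real m)) \<in> Z m"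
  proof -
    show "?r \<in> Z m" unfolding rz_in_Z_iff[OF assms] using assms by (intro exI[of _ 1]) simp
    then show "rz (- (2 * pi / real m)) \<in> Z m" by (rule Z_uminus[OF assms])
  qed
  show "A \<in> Z m \<or> hx ** A \<in> Z m" if "A \<in> D m"
    using that unfolding D_def
  proof (induction rule: generate.induct)
    case one then show ?case using Z_one[OF assms] by (simp add: O3_simps)
  next
    case (incl h) then show ?case using r Z_one[OF assms] by (auto simp: hx_hx)
  next
    case (inv h) then show ?case using r Z_one[OF assms] by (auto simp: hx_hx inv_gens)
  next
    case (eng A B)
    from eng.IH show ?case
    proof (elim disjE)
      assume "A \<in> Z m" "B \<in> Z m"
      then show ?thesis by (simp add: O3_simps Z_mult[OF assms])
    next
      assume "A \<in> Z m" "hx ** B \<in> Z m"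
      then have "(hx ** (A ** hx)) ** (hx ** B) \<in> Z m" by (blast intro: Z_mult[OF assms Z_hx_conj[OF assms]])
      moreover have "(hx ** (A ** hx)) ** (hx ** B) = hx ** (A ** B)"
        by (simp add: hx_cancel flip: matrix_mul_assoc)
      ultimately show ?thesis by (simp add: O3_simps)
    next
      assume "hx ** A \<in> Z m" "B \<in> Z m"
      then have "(hx ** A) ** B \<in> Z m" by (blast intro: Z_mult[OF assms])
      then show ?thesis by (simp add: O3_simps matrix_mul_assoc)
    next
      assume "hx ** A \<in> Z m" "hx ** B \<in> Z m"
      then have "(hx ** ((hx ** A) ** hx)) ** (hx ** B) \<in> Z m" by (blast intro: Z_mult[OF assms Z_hx_conj[OF assms]])
      moreover have "(hx ** ((hx ** A) ** hx)) ** (hx ** B) = A ** B"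
        by (simp add: hx_cancel flip: matrix_mul_assoc)
      ultimately show ?thesis by (simp add: O3_simps)
    qed
  qed
  have pow: "rz (2 * real j * pi / real m) \<in> D m" for j
  proof (induction j)
    case 0 then show ?case using generate.one[of O3] by (simp add: D_def rz_0 O3_simps)
  next
    case (Suc j)
    have "?r \<in> D m" unfolding D_def by (rule generate.incl) simp
    with Suc have "rz (2 * real j * pi / real m) ** ?r \<in> D m" by (rule D_mult)
    moreover have "2 * real (Suc j) * pi / m = 2 * real j * pi / m + 2 * pi / m"
      by (simp add: add_divide_distrib algebra_simps)
    ultimately show ?case unfolding rz_add by simp
  qed
  then have Z_D: "B \<in> D m" if "B \<in> Z m" for B using that by (auto simp: Z_def)
  have "hx \<in> D m" unfolding D_def by (rule generate.incl) simp
  then show "A \<in> D m" if "A \<in> Z m \<or> hx ** A \<in> Z m"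
    using that Z_D D_mult[of hx m "hx ** A"] by (auto simp: hx_cancel)
qed

lemma D_orthogonal: "m \<ge> 1 \<Longrightarrow> A \<in> D m \<Longrightarrow> orthogonal_matrix A"
  by (metis D_iff Z_E orthogonal_rz orthogonal_hx orthogonal_matrix_mul hx_cancel)

lemma D_det: "m \<ge> 1 \<Longrightarrow> A \<in> D m \<Longrightarrow> det A = 1"
  by (metis D_iff Z_E det_rz det_hx det_mul hx_cancel mult_1)

text \<open>The lower right entry says whether an element of \<open>D m\<close> keeps or reverses the vertical axis.
  Besides separating rotations from half-turns, it shows that a matrix whose entry is not \<open>\<plusminus>1\<close> is
  outside \<open>D m\<close>, which is how the generic conjugates below are handled.\<close>

lemma D_entry_33:
  assumes "m \<ge> 1" "A \<in> D m"
  shows "A $ 3 $ 3 = 1 \<and> A \<in> Z m \<or> A $ 3 $ 3 = -1 \<and> hx ** A \<in> Z m"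
proof -
  have "(hx ** B) $ 3 $ 3 = - (B $ 3 $ 3)" for B :: "real^3^3"
    by (simp add: mat3_mult hx_entries)
  then show ?thesis using assms by (metis D_iff Z_E rz_entries(9) minus_minus)
qed

section \<open>Subgroups of the dihedral reflection groups\<close>

text \<open>The coset formula for \<open>Dz k\<close>, used for \<open>k = 1\<close> too.  There it gives the group generated by
  the reflection in the plane orthogonal to \<open>e1\<close>, which is only conjugate to the conventional \<open>Dz 1\<close>;
  this removes a case distinction from the classification of subgroups.\<close>

definition Dz_std :: "nat \<Rightarrow> (real^3^3) set" where
  "Dz_std k = Z k \<union> {A. - (hx ** A) \<in> Z k}"

lemma Dz_std: assumes "k \<noteq> 1" shows "Dz k = Dz_std k"
proof -
  have "((- hx) <#\<^bsub>O3\<^esub> Z k) = {A. - (hx ** A) \<in> Z k}" (is "?L = ?R")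
  proof
    show "?L \<subseteq> ?R"
      by (auto simp: l_coset_def O3_simps uminus_mult mult_uminus hx_cancel)
    show "?R \<subseteq> ?L"
    proof
      fix A assume "A \<in> ?R"
      moreover have "A = (- hx) ** (- (hx ** A))"
        by (simp add: uminus_mult mult_uminus hx_cancel)
      ultimately show "A \<in> ?L" by (auto simp: l_coset_def O3_simps)
    qed
  qed
  then show ?thesis using assms by (simp add: Dz_def Dz_std_def)
qed

lemma conj_set_iff:
  assumes "orthogonal_matrix g"
  shows "A \<in> conj_set g K \<longleftrightarrow> tr g ** A ** g \<in> K"
proof -
  interpret group O3 by (rule group_O3)
  have g: "tr g ** g = mat 1" "g ** tr g = mat 1" using assms by (auto simp: orthogonal_matrix_def)
  have inv: "inv\<^bsub>O3\<^esub> g = tr g"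
    by (rule inv_equality) (use assms in \<open>auto simp: O3_simps orthogonal_matrix_def\<close>)
  have "tr g ** (g ** k ** tr g) ** g = k" for k
    by (metis g(1) matrix_mul_assoc matrix_mul_lid matrix_mul_rid)
  moreover have "g ** (tr g ** A ** g) ** tr g = A"
    by (metis g(2) matrix_mul_assoc matrix_mul_lid matrix_mul_rid)
  ultimately show ?thesis
    unfolding conj_set_def inv O3_simps by (metis (no_types, lifting) image_iff)
qed

text \<open>The exchange of \<open>e1\<close> and \<open>e3\<close>.  It carries the half-turn about \<open>e1\<close> to the one about \<open>e3\<close>:
  this reconciles the two versions of \<open>Dz 1\<close>, and it also provides conjugates whose axis is horizontal.\<close>

definition swap13 :: "real^3^3" where
  "swap13 = vector [vector [0, 0, 1], vector [0, 1, 0], vector [1, 0, 0]]"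

lemma swap13_entries:
  "swap13 $ 1 $ 1 = 0" "swap13 $ 1 $ 2 = 0" "swap13 $ 1 $ 3 = 1"
  "swap13 $ 2 $ 1 = 0" "swap13 $ 2 $ 2 = 1" "swap13 $ 2 $ 3 = 0"
  "swap13 $ 3 $ 1 = 1" "swap13 $ 3 $ 2 = 0" "swap13 $ 3 $ 3 = 0"
  by (simp_all add: swap13_def)

lemma tr_swap13: "tr swap13 = swap13"
  by (simp add: mat3_eq_iff Finite_Cartesian_Product.transpose_def swap13_entries)

lemma orthogonal_swap13: "orthogonal_matrix swap13"
  unfolding orthogonal_matrix tr_swap13
  by (simp add: mat3_eq_iff mat3_mult swap13_entries mat1_entries)

lemma swap13_hx: "swap13 ** hx ** swap13 = rz pi"
  by (simp add: mat3_eq_iff mat3_mult swap13_entries hx_entries rz_entries)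

lemma swap13_rz_pi: "swap13 ** rz pi ** swap13 = hx"
  by (simp add: mat3_eq_iff mat3_mult swap13_entries hx_entries rz_entries)

lemma Dz_std_orthogonal:
  assumes "A \<in> Dz_std k" shows "orthogonal_matrix A"
proof -
  from assms consider a where "A = rz a" | a where "- (hx ** A) = rz a"
    unfolding Dz_std_def by (auto elim: Z_E)
  then show ?thesis
  proof cases
    case 1 then show ?thesis by (simp add: orthogonal_rz)
  next
    case 2
    then have "A = - (hx ** rz a)" by (metis hx_cancel mult_uminus minus_minus)
    then show ?thesis by (simp add: orthogonal_uminus orthogonal_rz orthogonal_hx orthogonal_matrix_mul)
  qed
qed

lemma conj_class_Dz:
  assumes "k \<ge> 1" shows "conj_class (Dz_std k) = conj_class (Dz k)"
proof (cases "k = 1")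
  case False then show ?thesis by (simp add: Dz_std)
next
  case True
  have "A \<in> Dz_std 1 \<longleftrightarrow> A \<in> conj_set swap13 Z2_minus" for A
  proof -
    have s: "swap13 ** swap13 = mat 1"
      using orthogonal_swap13 by (simp add: orthogonal_matrix tr_swap13)
    have eq: "swap13 ** A ** swap13 = B \<longleftrightarrow> A = swap13 ** B ** swap13" for B
      by (metis s matrix_mul_assoc matrix_mul_lid matrix_mul_rid)
    have "- (hx ** A) = mat 1 \<longleftrightarrow> A = - hx"
      by (metis hx_cancel hx_hx mult_uminus minus_minus matrix_mul_rid)
    moreover have "swap13 ** (- rz pi) ** swap13 = - hx"
      by (simp add: uminus_mult mult_uminus swap13_rz_pi)
    ultimately show ?thesis
      unfolding conj_set_iff[OF orthogonal_swap13] tr_swap13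
      by (simp add: Dz_std_def Z_1[unfolded One_nat_def] Z_1 triv_def Z2_minus_def eq s)
  qed
  then have "Dz_std 1 = conj_set swap13 (Dz 1)" by (auto simp: Dz_def)
  moreover have "Dz 1 \<subseteq> carrier O3"
  proof
    fix A assume "A \<in> Dz 1"
    then have "A = mat 1 \<or> A = - rz pi" by (simp add: Dz_def Z2_minus_def)
    then show "A \<in> carrier O3"
      by (auto simp: O3_simps orthogonal_matrix_id orthogonal_uminus orthogonal_rz)
  qed
  ultimately show ?thesis
    using True conj_class_conj_set[of swap13 "Dz 1"] orthogonal_swap13 by (simp add: O3_simps)
qed

text \<open>Any reflection \<open>F\<close> in \<open>S\<close> is an involution, so multiplication by \<open>F\<close> exchanges the rotations and
  the reflections of \<open>S\<close>, and \<open>S\<close> is determined by \<open>F\<close> and \<open>Z k\<close>.  A rotation about \<open>e3\<close> centralises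
  \<open>Z k\<close> and moves \<open>F\<close> to any other vertical reflection, in particular to \<open>- hx\<close>.\<close>

lemma conj_class_of_rotations:
  assumes mult: "\<And>A B. A \<in> S \<Longrightarrow> B \<in> S \<Longrightarrow> A ** B \<in> S"
    and sub: "S \<subseteq> Dz_std n"
    and rots: "S \<inter> range rz = Z k" and k: "k \<ge> 1"
  shows "conj_class S = (if S \<subseteq> Z n then conj_class (Z k) else conj_class (Dz k))"
proof (cases "S \<subseteq> Z n")
  case True
  then have "S \<subseteq> range rz" by (blast elim: Z_E)
  with rots have "S = Z k" by blast
  with True show ?thesis by simp
next
  case False
  then obtain F where F: "F \<in> S" "F \<notin> Z n" by blast
  then have "- (hx ** F) \<in> Z n" using sub by (auto simp: Dz_std_def)
  then obtain a where "- (hx ** F) = rz a" by (auto elim: Z_E)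
  then have Fa: "F = - (hx ** rz a)" by (metis hx_cancel mult_uminus minus_minus)
  have FF: "F ** (F ** A) = A" for A
  proof -
    have "F ** F = mat 1" by (simp add: Fa uminus_mult mult_uminus flip_flip)
    then show ?thesis by (simp add: matrix_mul_assoc)
  qed
  have mem: "A \<in> S \<longleftrightarrow> A \<in> Z k \<or> F ** A \<in> Z k" for A
  proof
    assume A: "A \<in> S"
    show "A \<in> Z k \<or> F ** A \<in> Z k"
    proof (cases "A \<in> range rz")
      case True then show ?thesis using A rots by blast
    next
      case False
      then have "- (hx ** A) \<in> Z n" using sub A unfolding Dz_std_def by (blast elim: Z_E)
      then obtain b where "- (hx ** A) = rz b" by (auto elim: Z_E)
      then have Ab: "A = - (hx ** rz b)" by (metis hx_cancel mult_uminus minus_minus)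
      have "F ** A = hx ** (rz a ** hx) ** rz b"
        by (simp add: Fa Ab uminus_mult mult_uminus flip: matrix_mul_assoc)
      then have "F ** A = rz (b - a)" by (simp add: rz_hx hx_cancel rz_add)
      then show ?thesis using mult[OF F(1) A] rots by blast
    qed
  next
    assume "A \<in> Z k \<or> F ** A \<in> Z k"
    moreover have "Z k \<subseteq> S" using rots by blast
    ultimately have "A \<in> S \<or> F ** (F ** A) \<in> S" using mult[OF F(1)] by blast
    then show "A \<in> S" unfolding FF by blast
  qed
  \<comment> \<open>Conjugating \<open>hx\<close> by \<open>rz p\<close> gives \<open>hx ** rz (- 2 * p)\<close>: half the angle is needed.\<close>
  define p where "p = - a / 2"
  have a: "a = - (p + p)" by (simp add: p_def)
  let ?g = "rz p"
  have "A \<in> S \<longleftrightarrow> A \<in> conj_set ?g (Dz_std k)" for A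
  proof -
    have conjg: "tr ?g ** A ** ?g \<in> Z k \<longleftrightarrow> A \<in> Z k" for A
    proof -
      have 1: "tr ?g ** A ** ?g = A" if "A \<in> Z k" for A
        using that by (auto elim!: Z_E simp: tr_rz rz_add)
      have 2: "A = ?g ** (tr ?g ** A ** ?g) ** tr ?g"
        by (metis (no_types, lifting) orthogonal_rz orthogonal_matrix_def matrix_mul_assoc matrix_mul_lid matrix_mul_rid)
      show ?thesis
      proof
        assume *: "tr ?g ** A ** ?g \<in> Z k"
        then have "?g ** (tr ?g ** A ** ?g) ** tr ?g = tr ?g ** A ** ?g"
          by (auto elim!: Z_E simp: tr_rz rz_add)
        with 2 * show "A \<in> Z k" by simp
      qed (simp add: 1)
    qed
    have "- (hx ** (tr ?g ** A ** ?g)) = tr ?g ** (F ** A) ** ?g"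
    proof -
      have "tr ?g ** (hx ** rz a) = hx ** tr ?g"
        by (simp add: a tr_rz matrix_mul_assoc rz_hx) (simp add: rz_add flip: matrix_mul_assoc)
      then show ?thesis
        unfolding Fa by (simp add: uminus_mult mult_uminus matrix_mul_assoc)
    qed
    then show ?thesis
      unfolding conj_set_iff[OF orthogonal_rz] mem by (simp add: Dz_std_def conjg)
  qed
  then have "S = conj_set ?g (Dz_std k)" by blast
  then show ?thesis
    using False conj_class_conj_set[of ?g "Dz_std k"] conj_class_Dz[OF k] Dz_std_orthogonal
    by (auto simp: O3_simps orthogonal_rz)
qed


section \<open>The class of an intersection\<close>

lemma Dz_std_mult:
  assumes n: "n \<ge> 1" and "A \<in> Dz_std n" "B \<in> Dz_std n" shows "A ** B \<in> Dz_std n"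
proof -
  note assoc = matrix_mul_assoc[symmetric]
  from assms consider "A \<in> Z n" "B \<in> Z n" | "A \<in> Z n" "- (hx ** B) \<in> Z n"
    | "- (hx ** A) \<in> Z n" "B \<in> Z n" | "- (hx ** A) \<in> Z n" "- (hx ** B) \<in> Z n"
    unfolding Dz_std_def by blast
  then show ?thesis
  proof cases
    case 1 then show ?thesis by (simp add: Dz_std_def Z_mult[OF n])
  next
    case 2
    then have "(hx ** (A ** hx)) ** (- (hx ** B)) \<in> Z n" by (blast intro: Z_mult[OF n Z_hx_conj[OF n]])
    then show ?thesis by (simp add: Dz_std_def hx_cancel mult_uminus assoc)
  next
    case 3
    then have "(- (hx ** A)) ** B \<in> Z n" by (blast intro: Z_mult[OF n])
    then show ?thesis by (simp add: Dz_std_def uminus_mult assoc)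
  next
    case 4
    then have "(hx ** ((- (hx ** A)) ** hx)) ** (- (hx ** B)) \<in> Z n" by (blast intro: Z_mult[OF n Z_hx_conj[OF n]])
    then show ?thesis by (simp add: Dz_std_def hx_cancel mult_uminus uminus_mult assoc)
  qed
qed

lemma plus_Z2c_D_mult:
  assumes "A \<in> plus_Z2c (D m)" "B \<in> plus_Z2c (D m)" shows "A ** B \<in> plus_Z2c (D m)"
  using assms D_mult[of _ m] by (auto simp: plus_Z2c_def uminus_mult mult_uminus)

lemma plus_Z2c_D_iff:
  assumes "m \<ge> 1" "det A = 1"
  shows "A \<in> plus_Z2c (D m) \<longleftrightarrow> A \<in> D m" "- A \<in> plus_Z2c (D m) \<longleftrightarrow> A \<in> D m"
  using assms D_det[OF assms(1), of "- A"]
  by (auto simp: plus_Z2c_def det_uminus_3)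

lemma conj_cancel:
  fixes g :: "real^3^3"
  assumes "orthogonal_matrix g"
  shows "g ** (tr g ** A) = A" "tr g ** (g ** A) = A"
  using assms by (simp_all add: orthogonal_matrix_def matrix_mul_assoc)

lemma conj_mult:
  fixes g :: "real^3^3"
  assumes "orthogonal_matrix g"
  shows "tr g ** (A ** B) ** g = (tr g ** A ** g) ** (tr g ** B ** g)"
  by (simp add: conj_cancel[OF assms] flip: matrix_mul_assoc)

lemma conj_eq_one_iff:
  fixes g :: "real^3^3"
  assumes "orthogonal_matrix g"
  shows "tr g ** A ** g = mat 1 \<longleftrightarrow> A = mat 1"
proof
  assume "tr g ** A ** g = mat 1"
  then have "g ** (tr g ** A ** g) ** tr g = g ** mat 1 ** tr g" by simp
  then show "A = mat 1"
    using assms by (simp add: conj_cancel[OF assms] orthogonal_matrix_def flip: matrix_mul_assoc)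
qed (use assms in \<open>simp add: orthogonal_matrix_def\<close>)

lemma det_conj:
  fixes g :: "real^3^3"
  assumes "orthogonal_matrix g"
  shows "det (tr g ** A ** g) = det A"
proof -
  have "det g * det g = 1" using det_orthogonal_matrix[OF assms] by auto
  then show ?thesis by (simp add: det_mul algebra_simps)
qed

lemma trace_conj:
  fixes g :: "real^3^3"
  assumes "orthogonal_matrix g"
  shows "trace (tr g ** A ** g) = trace A"
  by (metis trace_mul_sym conj_cancel(1)[OF assms] matrix_mul_assoc)

text \<open>The intersection whose class belongs to the clips, for the conjugating element \<open>g\<close>.\<close>

abbreviation cut :: "nat \<Rightarrow> nat \<Rightarrow> real^3^3 \<Rightarrow> (real^3^3) set" where
  "cut m n g \<equiv> Dz_std n \<inter> conj_set g (plus_Z2c (D m))"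

text \<open>Determinants reduce membership in the conjugate of \<open>plus_Z2c (D m)\<close> to membership in the
  conjugate of \<open>D m\<close>, for the rotations \<open>A\<close> of \<open>Dz n\<close> and for the half-turns \<open>hx ** A\<close> whose negatives are
  its reflections.\<close>

lemma conj_class_cut:
  assumes g: "orthogonal_matrix g" and mn: "m \<ge> 1" "n \<ge> 1" and k: "k \<ge> 1"
    and rots: "{A \<in> Z n. tr g ** A ** g \<in> D m} = Z k"
  shows "conj_class (cut m n g) =
    (if \<exists>A\<in>Z n. tr g ** (hx ** A) ** g \<in> D m then conj_class (Dz k) else conj_class (Z k))"
proof -
  have det: "det (tr g ** A ** g) = 1" "det (tr g ** (hx ** A) ** g) = 1" if "A \<in> Z n" for A
    using that by (auto elim!: Z_E simp: det_conj[OF g] det_mul[of hx] det_hx det_rz)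
  have rotation: "A \<in> cut m n g \<longleftrightarrow> tr g ** A ** g \<in> D m" if "A \<in> Z n" for A
    using that det[OF that] by (simp add: conj_set_iff[OF g] plus_Z2c_D_iff[OF mn(1)] Dz_std_def)
  have reflection: "- (hx ** A) \<in> cut m n g \<longleftrightarrow> tr g ** (hx ** A) ** g \<in> D m" if "A \<in> Z n" for A
    using that det[OF that]
    by (simp add: conj_set_iff[OF g] uminus_mult mult_uminus plus_Z2c_D_iff[OF mn(1)] Dz_std_def hx_cancel)
  have no_rotation: "- (hx ** A) \<notin> range rz" if "A \<in> Z n" for A
  proof
    assume "- (hx ** A) \<in> range rz"
    then have "det (- (hx ** A)) = 1" by (auto simp: det_rz)
    then show False using that by (auto elim!: Z_E simp: det_uminus_3 det_mul det_hx det_rz)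
  qed
  have split: "A \<in> Z n \<or> (\<exists>B\<in>Z n. A = - (hx ** B))" if "A \<in> Dz_std n" for A
  proof -
    have "A = - (hx ** (- (hx ** A)))" by (simp add: mult_uminus hx_cancel)
    then show ?thesis using that unfolding Dz_std_def by blast
  qed
  have "cut m n g \<inter> range rz = Z k"
  proof -
    have "A \<in> cut m n g \<inter> range rz \<longleftrightarrow> A \<in> {A \<in> Z n. tr g ** A ** g \<in> D m}" for A
    proof (cases "A \<in> Z n")
      case True
      then have "A \<in> range rz" by (blast elim: Z_E)
      then show ?thesis using rotation[OF True] True by blast
    next
      case False
      have "A \<notin> range rz" if A: "A \<in> Dz_std n"
      proof -
        obtain B where "B \<in> Z n" "A = - (hx ** B)" using split[OF A] False by blast
        then show ?thesis using no_rotation by simp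
      qed
      then show ?thesis using False by blast
    qed
    then show ?thesis using rots by blast
  qed
  moreover have "A ** B \<in> cut m n g" if "A \<in> cut m n g" "B \<in> cut m n g" for A B
    using that Dz_std_mult[OF mn(2)] plus_Z2c_D_mult by (auto simp: conj_set_iff[OF g] conj_mult[OF g])
  moreover have "cut m n g \<subseteq> Dz_std n" by blast
  ultimately have "conj_class (cut m n g) =
      (if cut m n g \<subseteq> Z n then conj_class (Z k) else conj_class (Dz k))"
    by (intro conj_class_of_rotations k) auto
  moreover have "cut m n g \<subseteq> Z n \<longleftrightarrow> \<not> (\<exists>A\<in>Z n. tr g ** (hx ** A) ** g \<in> D m)"
  proof -
    have "\<not> cut m n g \<subseteq> Z n" if "A \<in> Z n" "tr g ** (hx ** A) ** g \<in> D m" for A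
      using reflection[OF that(1)] that no_rotation[OF that(1)] by (blast elim: Z_E)
    moreover have "A \<in> Z n" if "A \<in> cut m n g" "\<not> (\<exists>A\<in>Z n. tr g ** (hx ** A) ** g \<in> D m)" for A
      using split[of A] reflection that by blast
    ultimately show ?thesis by blast
  qed
  ultimately show ?thesis by auto
qed

section \<open>Common rotations\<close>

lemma orthogonal_entries:
  fixes g :: "real^3^3"
  assumes "orthogonal_matrix g"
  shows "(g$1$3)\<^sup>2 + (g$2$3)\<^sup>2 + (g$3$3)\<^sup>2 = 1" "(g$3$1)\<^sup>2 + (g$3$2)\<^sup>2 + (g$3$3)\<^sup>2 = 1"
    "(g$1$1)\<^sup>2 + (g$2$1)\<^sup>2 + (g$3$1)\<^sup>2 = 1" "(g$1$2)\<^sup>2 + (g$2$2)\<^sup>2 + (g$3$2)\<^sup>2 = 1"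
proof -
  have "tr g ** g = mat 1" "g ** tr g = mat 1" using assms by (auto simp: orthogonal_matrix_def)
  then show "(g$1$3)\<^sup>2 + (g$2$3)\<^sup>2 + (g$3$3)\<^sup>2 = 1" "(g$3$1)\<^sup>2 + (g$3$2)\<^sup>2 + (g$3$3)\<^sup>2 = 1"
    "(g$1$1)\<^sup>2 + (g$2$1)\<^sup>2 + (g$3$1)\<^sup>2 = 1" "(g$1$2)\<^sup>2 + (g$2$2)\<^sup>2 + (g$3$2)\<^sup>2 = 1"
    by (simp_all add: mat3_eq_iff mat3_mult Finite_Cartesian_Product.transpose_def mat1_entries power2_eq_square)
qed

text \<open>The condition on the entry says that \<open>g e3 = \<plusminus>e3\<close>, as columns and rows are unit vectors.\<close>

lemma axis_kept_entries:
  fixes g :: "real^3^3"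
  assumes "orthogonal_matrix g" "(g$3$3)\<^sup>2 = 1"
  shows "g$1$3 = 0" "g$2$3 = 0" "g$3$1 = 0" "g$3$2 = 0"
  using orthogonal_entries(1,2)[OF assms(1)] assms(2) by (auto simp: sum_power2_eq_zero_iff)

text \<open>The upper left block is a plane isometry of determinant 1.  The key identity is that
  \<open>(B11 - B22)\<^sup>2 + (B12 + B21)\<^sup>2\<close> is the sum of the squared lengths of its columns minus twice its
  determinant, hence zero.\<close>

lemma rotation_about_e3:
  fixes B :: "real^3^3"
  assumes B: "orthogonal_matrix B" "det B = 1" "B$3$3 = 1"
  obtains b where "B = rz b"
proof -
  have z: "B$1$3 = 0" "B$2$3 = 0" "B$3$1 = 0" "B$3$2 = 0"
    using axis_kept_entries[OF B(1)] B(3) by auto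
  have n: "(B$1$1)\<^sup>2 + (B$2$1)\<^sup>2 = 1" "(B$1$2)\<^sup>2 + (B$2$2)\<^sup>2 = 1"
    using orthogonal_entries(3,4)[OF B(1)] z by auto
  have d: "B$1$1 * B$2$2 - B$1$2 * B$2$1 = 1" using B(2,3) z by (simp add: det_3)
  have "(B$1$1 - B$2$2)\<^sup>2 + (B$1$2 + B$2$1)\<^sup>2
      = ((B$1$1)\<^sup>2 + (B$2$1)\<^sup>2) + ((B$1$2)\<^sup>2 + (B$2$2)\<^sup>2) - 2 * (B$1$1 * B$2$2 - B$1$2 * B$2$1)"
    by (simp add: power2_eq_square algebra_simps)
  also have "\<dots> = 0" unfolding n d by simp
  finally have "B$2$2 = B$1$1" "B$1$2 = - B$2$1" by (auto simp: sum_power2_eq_zero_iff)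
  moreover obtain b where "B$1$1 = cos b" "B$2$1 = sin b" using sincos_total_2pi[OF n(1)] by metis
  ultimately have "B = rz b" using z B(3) by (simp add: mat3_eq_iff rz_entries)
  then show ?thesis by (rule that)
qed

text \<open>The conjugate of a rotation about \<open>e3\<close> is again one, and equality of traces forces its angle to
  be the same up to sign; so conjugation by \<open>g\<close> does not affect membership in \<open>Z m\<close>.\<close>

lemma rotations_axis_kept:
  assumes g: "orthogonal_matrix g" "(g$3$3)\<^sup>2 = 1" and mn: "m \<ge> 1" "n \<ge> 1"
  shows "{A \<in> Z n. tr g ** A ** g \<in> D m} = Z (gcd m n)"
proof -
  have "tr g ** A ** g \<in> D m \<longleftrightarrow> A \<in> Z m" if "A \<in> Z n" for A
  proof -
    obtain a where a: "A = rz a" using \<open>A \<in> Z n\<close> by (rule Z_E)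
    let ?B = "tr g ** A ** g"
    have "?B $ 3 $ 3 = (g$3$3)\<^sup>2"
      by (simp add: a mat3_mult rz_entries axis_kept_entries[OF g] Finite_Cartesian_Product.transpose_def power2_eq_square)
    then have B33: "?B $ 3 $ 3 = 1" using g(2) by simp
    have "orthogonal_matrix ?B"
      using g(1) by (simp add: a orthogonal_matrix_mul orthogonal_rz orthogonal_matrix_transpose)
    moreover have "det ?B = 1" by (simp add: det_conj[OF g(1)] a det_rz)
    ultimately obtain b where b: "?B = rz b" using B33 by (rule rotation_about_e3)
    have "trace (rz b) = trace (rz a)" using trace_conj[OF g(1), of A] b a by simp
    then have "cos b = cos a" by (simp add: trace_def sum_3 rz_entries)
    then have "rz b = rz a \<or> rz b = rz (- a)" by (rule rz_cos_cases)
    then have "?B \<in> Z m \<longleftrightarrow> A \<in> Z m"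
      unfolding b unfolding a using Z_uminus[OF mn(1), of a] Z_uminus[OF mn(1), of "- a"] by auto
    moreover have "?B \<in> D m \<longleftrightarrow> ?B \<in> Z m" using D_entry_33[OF mn(1), of ?B] B33 D_iff[OF mn(1)] by auto
    ultimately show ?thesis by simp
  qed
  then show ?thesis using Z_Int_Z[OF mn] by blast
qed

text \<open>If the conjugated rotation is in \<open>Z m\<close>, then \<open>rz a\<close> fixes \<open>g e3\<close>, which has a nonzero horizontal
  part; a plane rotation fixing a nonzero vector is trivial.  Otherwise it is a half-turn of \<open>D m\<close>.\<close>

lemma rotation_axis_moved:
  assumes g: "orthogonal_matrix g" "(g$3$3)\<^sup>2 \<noteq> 1" and m: "m \<ge> 1"
    and A: "tr g ** rz a ** g \<in> D m"
  shows "rz a = mat 1 \<or> rz a = rz pi"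
proof -
  let ?B = "tr g ** rz a ** g"
  have "?B \<in> Z m \<or> hx ** ?B \<in> Z m" using A D_iff[OF m] by blast
  then show ?thesis
  proof
    assume "?B \<in> Z m"
    then obtain b where b: "?B = rz b" by (auto elim: Z_E)
    have "rz a ** g = g ** ?B" by (simp add: conj_cancel[OF g(1)] flip: matrix_mul_assoc)
    then have *: "(rz a ** g) $ i $ 3 = (g ** rz b) $ i $ 3" for i by (simp add: b)
    have "cos a * g$1$3 - sin a * g$2$3 = g$1$3" "sin a * g$1$3 + cos a * g$2$3 = g$2$3"
      using *[of 1] *[of 2] by (simp_all add: mat3_mult rz_entries)
    then have "g$1$3 * (cos a * g$1$3 - sin a * g$2$3) + g$2$3 * (sin a * g$1$3 + cos a * g$2$3)
        = g$1$3 * g$1$3 + g$2$3 * g$2$3" by simp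
    then have "(1 - cos a) * ((g$1$3)\<^sup>2 + (g$2$3)\<^sup>2) = 0"
      by (simp add: algebra_simps power2_eq_square)
    moreover have "(g$1$3)\<^sup>2 + (g$2$3)\<^sup>2 \<noteq> 0" using orthogonal_entries(1)[OF g(1)] g(2) by linarith
    ultimately have "cos a = cos 0" unfolding mult_eq_0_iff by auto
    then have "rz a = rz 0 \<or> rz a = rz (- 0)" by (rule rz_cos_cases)
    then show ?thesis by (simp add: rz_0)
  next
    assume "hx ** ?B \<in> Z m"
    then obtain b where "hx ** ?B = rz b" by (auto elim: Z_E)
    then have "?B = hx ** rz b" by (metis hx_cancel)
    then have "?B ** ?B = mat 1" using flip_flip by (simp only:)
    then have "rz a ** rz a = mat 1"
      unfolding conj_mult[OF g(1), symmetric] conj_eq_one_iff[OF g(1)] .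
    then show ?thesis by (rule rz_square_one)
  qed
qed

lemma rotations_axis_moved:
  assumes g: "orthogonal_matrix g" "(g$3$3)\<^sup>2 \<noteq> 1" and mn: "m \<ge> 1" "n \<ge> 1"
  shows "{A \<in> Z n. tr g ** A ** g \<in> D m} =
    Z (if even n \<and> tr g ** rz pi ** g \<in> D m then 2 else 1)"
proof -
  have "A = mat 1 \<or> A = rz pi" if "A \<in> Z n" "tr g ** A ** g \<in> D m" for A
    using that rotation_axis_moved[OF g mn(1)] by (blast elim: Z_E)
  moreover have "mat 1 \<in> Z n" by (rule Z_one[OF mn(2)])
  moreover have "tr g ** mat 1 ** g \<in> D m"
    using D_iff[OF mn(1)] Z_one[OF mn(1)] g(1) by (simp add: orthogonal_matrix_def)
  ultimately have "{A \<in> Z n. tr g ** A ** g \<in> D m} =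
      (if rz pi \<in> Z n \<and> tr g ** rz pi ** g \<in> D m then {mat 1, rz pi} else {mat 1})"
    by auto
  then show ?thesis
    unfolding rz_pi_in_Z_iff[OF mn(2)] if_distrib[of Z] Z_1 Z_2 triv_def .
qed

text \<open>\<open>Z m\<close> has no element of order 2, so no involution of the conjugate of \<open>D m\<close> is a conjugate from
  \<open>Z m\<close>.  The half-turn about \<open>e3\<close> and a half-turn about a horizontal axis are therefore both flips of
  that dihedral group, and their product, which is again an involution, comes from \<open>Z m\<close>: a
  contradiction.\<close>

lemma no_reflection_odd:
  assumes g: "orthogonal_matrix g" and m: "m \<ge> 1" "odd m"
    and half_turn: "tr g ** rz pi ** g \<in> D m"
  shows "tr g ** (hx ** rz a) ** g \<notin> D m"
proof
  let ?c = "\<lambda>A. tr g ** A ** g"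
  have not_rot: "?c C \<notin> Z m" if "C ** C = mat 1" "C \<noteq> mat 1" for C
  proof
    assume *: "?c C \<in> Z m"
    then obtain b where b: "?c C = rz b" by (auto elim: Z_E)
    have "?c C ** ?c C = mat 1" unfolding conj_mult[OF g, symmetric] conj_eq_one_iff[OF g] by fact
    then have "rz b = mat 1 \<or> rz b = rz pi" unfolding b by (rule rz_square_one)
    then show False using that(2) conj_eq_one_iff[OF g, of C] * rz_pi_in_Z_iff[OF m(1)] m(2) b by auto
  qed
  have not_one: "hx ** rz b \<noteq> mat 1" for b
  proof
    assume "hx ** rz b = mat 1"
    then have "(hx ** rz b) $ 3 $ 3 = (mat 1 :: real^3^3) $ 3 $ 3" by simp
    then show False by (simp add: mat3_mult hx_entries rz_entries mat1_entries)
  qed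
  assume "?c (hx ** rz a) \<in> D m"
  then have 1: "hx ** ?c (hx ** rz a) \<in> Z m" using D_iff[OF m(1)] not_rot[OF flip_flip not_one] by blast
  have "rz pi ** rz pi = rz 0" unfolding rz_add rz_eq_iff by (intro exI[of _ 1]) simp
  moreover have "rz pi \<noteq> mat 1" by (simp add: mat3_eq_iff rz_entries mat1_entries)
  ultimately have 2: "hx ** ?c (rz pi) \<in> Z m"
    using D_iff[OF m(1)] half_turn not_rot[of "rz pi"] by (auto simp: rz_0)
  have "(hx ** ((hx ** ?c (hx ** rz a)) ** hx)) ** (hx ** ?c (rz pi)) \<in> Z m"
    using 1 2 by (blast intro: Z_mult[OF m(1) Z_hx_conj[OF m(1)]])
  then have "?c (hx ** rz a) ** ?c (rz pi) \<in> Z m"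
    by (simp add: hx_cancel flip: matrix_mul_assoc)
  then have "?c (hx ** rz (a + pi)) \<in> Z m"
    unfolding conj_mult[OF g, symmetric] by (simp add: rz_add flip: matrix_mul_assoc)
  then show False using not_rot[OF flip_flip not_one] by blast
qed

section \<open>Conjugating elements in special and in generic position\<close>

text \<open>Premultiplying the conjugating element by \<open>rz p\<close> leaves the common rotations unchanged and turns
  the reflections by \<open>2 * p\<close>; this is how reflections are avoided without changing \<open>k\<close>.\<close>

lemma conj_rz_mult:
  "tr (rz p ** h) ** (hx ** rz a) ** (rz p ** h) = tr h ** (hx ** rz (a + 2 * p)) ** h"
  "tr (rz p ** h) ** rz a ** (rz p ** h) = tr h ** rz a ** h"
proof -
  have 1: "rz (- p) ** (hx ** rz a) ** rz p = hx ** rz (a + 2 * p)"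
    by (simp add: matrix_mul_assoc rz_hx) (simp add: rz_add algebra_simps flip: matrix_mul_assoc)
  have 2: "rz (- p) ** rz a ** rz p = rz a" by (simp add: rz_add)
  have "tr (rz p ** h) ** B ** (rz p ** h) = tr h ** (rz (- p) ** B ** rz p) ** h" for B
    by (simp add: matrix_transpose_mul tr_rz matrix_mul_assoc)
  then show "tr (rz p ** h) ** (hx ** rz a) ** (rz p ** h) = tr h ** (hx ** rz (a + 2 * p)) ** h"
    "tr (rz p ** h) ** rz a ** (rz p ** h) = tr h ** rz a ** h"
    using 1 2 by simp_all
qed

text \<open>Turned by \<open>pi / (4 * n)\<close>, no half-turn axis of \<open>D n\<close> lies along \<open>e1\<close> or \<open>e2\<close>: clearing
  denominators, that would equate an odd and an even integer.\<close>

lemma sin_shifted: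
  assumes n: "n \<ge> 1" and "rz a \<in> Z n" shows "sin (a + 2 * (pi / (4 * n))) \<noteq> 0"
proof
  assume "sin (a + 2 * (pi / (4 * n))) = 0"
  then obtain k :: int where k: "a + 2 * (pi / (4 * n)) = k * pi" by (auto simp: sin_zero_iff_int2)
  obtain i :: int where i: "a * n = 2 * pi * i" using assms by (auto simp: rz_in_Z_iff)
  have "a * n + pi / 2 = (a + 2 * (pi / (4 * n))) * n" using n by (simp add: field_simps)
  then have "2 * pi * i + pi / 2 = k * pi * n" unfolding i k .
  then have "pi * (4 * of_int i + 1) = pi * (2 * of_int k * real n)" by (simp add: field_simps)
  then have "4 * of_int i + 1 = 2 * of_int k * real n" by (simp only: mult_cancel_left pi_neq_zero simp_thms)
  then have "real_of_int (4 * i + 1) = of_int (2 * (k * int n))" by simp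
  then have "4 * i + 1 = 2 * (k * int n)" unfolding of_int_eq_iff .
  then show False by presburger
qed

text \<open>Turning by \<open>pi / (2 * m * n)\<close> separates the two systems of horizontal axes, again by parity.\<close>

lemma reflections_disjoint:
  assumes mn: "m \<ge> 1" "n \<ge> 1" and "rz a \<in> Z n"
  shows "hx ** rz (a + 2 * (pi / (2 * m * n))) \<notin> D m"
proof
  let ?p = "pi / (2 * m * n)"
  assume "hx ** rz (a + 2 * ?p) \<in> D m"
  moreover have "(hx ** rz (a + 2 * ?p)) $ 3 $ 3 = -1"
    by (simp add: mat3_mult hx_entries rz_entries)
  ultimately have "rz (a + 2 * ?p) \<in> Z m"
    using D_entry_33[OF mn(1), of "hx ** rz (a + 2 * ?p)"] by (auto simp: hx_cancel)
  then obtain j :: int where j: "(a + 2 * ?p) * m = 2 * pi * j" by (auto simp: rz_in_Z_iff[OF mn(1)])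
  obtain i :: int where i: "a * n = 2 * pi * i" using assms by (auto simp: rz_in_Z_iff)
  have "(a + 2 * ?p) * m * n = (a * n) * m + pi" using mn by (simp add: field_simps)
  then have "2 * pi * j * n = 2 * pi * i * m + pi" unfolding i j by simp
  then have "pi * (2 * of_int j * real n) = pi * (2 * of_int i * real m + 1)" by (simp add: algebra_simps)
  then have "2 * of_int j * real n = 2 * of_int i * real m + 1" by (simp only: mult_cancel_left pi_neq_zero simp_thms)
  then have "real_of_int (2 * (j * int n)) = of_int (2 * (i * int m) + 1)" by simp
  then have "2 * (j * int n) = 2 * (i * int m) + 1" unfolding of_int_eq_iff .
  then show False by presburger
qed

text \<open>The rotation by 45 degrees about \<open>e1\<close>.  It commutes with the reflection \<open>- hx\<close>, and the half-turn about
  \<open>e3\<close> becomes one whose lower right entry is the cosine of 90 degrees, so that it leaves \<open>D m\<close> for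
  every \<open>m\<close>.\<close>

definition tilt :: "real^3^3" where
  "tilt = (let s = sqrt (1/2) in vector [vector [1, 0, 0], vector [0, s, - s], vector [0, s, s]])"

lemma tilt_entries:
  "tilt $ 1 $ 1 = 1" "tilt $ 1 $ 2 = 0" "tilt $ 1 $ 3 = 0"
  "tilt $ 2 $ 1 = 0" "tilt $ 2 $ 2 = sqrt (1/2)" "tilt $ 2 $ 3 = - sqrt (1/2)"
  "tilt $ 3 $ 1 = 0" "tilt $ 3 $ 2 = sqrt (1/2)" "tilt $ 3 $ 3 = sqrt (1/2)"
  by (simp_all add: tilt_def Let_def)

lemma sqrt_half: "sqrt (1/2) * sqrt (1/2) = 1/2" "sqrt (1/2) * (sqrt (1/2) * x) = x/2"
  by (simp_all flip: mult.assoc add: real_sqrt_mult_self del: real_sqrt_divide)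

lemma orthogonal_tilt: "orthogonal_matrix tilt"
  unfolding orthogonal_matrix
  by (simp add: mat3_eq_iff mat3_mult Finite_Cartesian_Product.transpose_def tilt_entries mat1_entries sqrt_half
      del: real_sqrt_divide)

lemma tilt_hx: "tr tilt ** hx ** tilt = hx"
  by (simp add: mat3_eq_iff mat3_mult Finite_Cartesian_Product.transpose_def tilt_entries hx_entries sqrt_half
      del: real_sqrt_divide)

lemma tilt_rz_pi: "(tr tilt ** rz pi ** tilt) $ 3 $ 3 = 0"
  by (simp add: mat3_mult Finite_Cartesian_Product.transpose_def tilt_entries rz_entries)

lemma tilt_flip: "(tr tilt ** (hx ** rz c) ** tilt) $ 3 $ 3 = - (1 + cos c) / 2"
  by (simp add: mat3_mult Finite_Cartesian_Product.transpose_def tilt_entries hx_entries rz_entries sqrt_half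
      algebra_simps del: real_sqrt_divide)

lemma swap13_flip: "(swap13 ** (hx ** rz c) ** swap13) $ 3 $ 3 = cos c"
  by (simp add: mat3_mult swap13_entries hx_entries rz_entries)

lemma gcd_2_nat: "gcd 2 (n::nat) = (if even n then 2 else 1)"
proof (cases "even n")
  case False
  then have "coprime 2 n" by simp
  then show ?thesis using False by simp
qed (simp add: gcd_nat.absorb1)


section \<open>The clips\<close>

lemma sin_zero_of_cos: "cos c = 1 \<or> cos c = -1 \<Longrightarrow> sin (c::real) = 0"
  using sin_cos_squared_add[of c] by (auto simp: power2_eq_square)

lemma plus_Z2c_D_subset_O3:
  assumes "m \<ge> 1" shows "plus_Z2c (D m) \<subseteq> carrier O3"
  using D_orthogonal[OF assms] by (auto simp: plus_Z2c_def O3_simps orthogonal_uminus)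

lemma clips_eq_range:
  assumes "n \<ge> 2" "m \<ge> 1"
  shows "clips (conj_class (Dz n)) (conj_class (plus_Z2c (D m))) =
    {conj_class (cut m n g) | g. orthogonal_matrix g}"
proof -
  have "Dz n = Dz_std n" using assms(1) by (intro Dz_std) simp
  moreover have "Dz_std n \<subseteq> carrier O3" using Dz_std_orthogonal by (auto simp: O3_simps)
  ultimately show ?thesis
    using clips_conj_class[of "Dz_std n" "plus_Z2c (D m)"] plus_Z2c_D_subset_O3[OF assms(2)]
    by (simp add: O3_simps)
qed

lemma conj_class_cut_axis_kept:
  assumes "orthogonal_matrix g" "(g$3$3)\<^sup>2 = 1" "m \<ge> 1" "n \<ge> 1"
  shows "conj_class (cut m n g) =
    (if \<exists>A\<in>Z n. tr g ** (hx ** A) ** g \<in> D m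
     then conj_class (Dz (gcd m n)) else conj_class (Z (gcd m n)))"
  using assms by (intro conj_class_cut rotations_axis_kept) (auto simp: Suc_le_eq)

lemma conj_class_cut_axis_moved:
  assumes "orthogonal_matrix g" "(g$3$3)\<^sup>2 \<noteq> 1" "m \<ge> 1" "n \<ge> 1"
  shows "conj_class (cut m n g) =
    (if \<exists>A\<in>Z n. tr g ** (hx ** A) ** g \<in> D m
     then conj_class (Dz (if tr g ** rz pi ** g \<in> D m then gcd 2 n else 1))
     else conj_class (Z (if tr g ** rz pi ** g \<in> D m then gcd 2 n else 1)))"
proof -
  have k: "(if even n \<and> tr g ** rz pi ** g \<in> D m then 2 else 1) =
      (if tr g ** rz pi ** g \<in> D m then gcd 2 n else 1)"
    by (simp add: gcd_2_nat)
  show ?thesis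
    using assms rotations_axis_moved[OF assms] unfolding k
    by (intro conj_class_cut) (auto simp: Suc_le_eq)
qed

text \<open>With the axis moved, \<open>k = 2\<close> requires the half-turn about \<open>e3\<close> to be common, and then a reflection
  requires \<open>m\<close> to be even.  The trivial group and \<open>Z2_minus\<close> appear as \<open>Z 1\<close> and \<open>Dz 1\<close>, so that
  the three values of \<open>k\<close> are treated alike.\<close>

lemma clip_cases:
  assumes g: "orthogonal_matrix g" and mn: "m \<ge> 1" "n \<ge> 1"
  shows "conj_class (cut m n g) \<in>
      {conj_class (Z 1), conj_class (Z (gcd 2 n)), conj_class (Z (gcd m n)),
       conj_class (Dz 1), conj_class (Dz (gcd m n))}
    \<or> even m \<and> conj_class (cut m n g) = conj_class (Dz (gcd 2 n))"
proof (cases "(g$3$3)\<^sup>2 = 1")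
  case True
  then show ?thesis using conj_class_cut_axis_kept[OF g True mn] by simp
next
  case False
  show ?thesis
  proof (cases "tr g ** rz pi ** g \<in> D m \<and> odd m")
    case True
    then have "\<not> (\<exists>A\<in>Z n. tr g ** (hx ** A) ** g \<in> D m)"
      using no_reflection_odd[OF g mn(1)] by (blast elim: Z_E)
    then show ?thesis using conj_class_cut_axis_moved[OF g False mn] by simp
  next
    case False
    then show ?thesis
      using conj_class_cut_axis_moved[OF g \<open>(g$3$3)\<^sup>2 \<noteq> 1\<close> mn] by auto
  qed
qed

text \<open>The five conjugating elements are the tilt and the exchange of \<open>e1\<close> and \<open>e3\<close>, each followed by a
  small rotation, the small rotation alone, the tilt alone, and the identity.  The small rotations
  exclude reflections; the tilt alone and the identity keep the reflection \<open>- hx\<close>.\<close>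

lemma clip_witnesses:
  assumes m: "m \<ge> 1" and n: "n \<ge> 1"
  obtains g1 g2 g3 g4 g5 where
    "orthogonal_matrix g1" "conj_class (cut m n g1) = conj_class (Z 1)"
    "orthogonal_matrix g2" "conj_class (cut m n g2) = conj_class (Z (gcd 2 n))"
    "orthogonal_matrix g3" "conj_class (cut m n g3) = conj_class (Z (gcd m n))"
    "orthogonal_matrix g4" "conj_class (cut m n g4) = conj_class (Dz 1)"
    "orthogonal_matrix g5" "conj_class (cut m n g5) = conj_class (Dz (gcd m n))"
proof -
  let ?p = "pi / (4 * n)" and ?q = "pi / (2 * m * n)"
  have D33: "A \<notin> D m" if "A $ 3 $ 3 \<noteq> 1" "A $ 3 $ 3 \<noteq> -1" for A
    using D_entry_33[OF m] that by blast
  have hxD: "hx \<in> D m" using D_iff[OF m] Z_one[OF m] by (simp add: hx_hx)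
  have orth: "orthogonal_matrix (rz c ** tilt)" "orthogonal_matrix (rz c ** swap13)" for c
    by (simp_all add: orthogonal_matrix_mul orthogonal_rz orthogonal_tilt orthogonal_swap13)
  have moved: "(tilt$3$3)\<^sup>2 \<noteq> 1" "((rz c ** tilt)$3$3)\<^sup>2 \<noteq> 1" "((rz c ** swap13)$3$3)\<^sup>2 \<noteq> 1" for c
    by (simp_all add: mat3_mult rz_entries tilt_entries swap13_entries power2_eq_square sqrt_half
        del: real_sqrt_divide)
  have tilt_half_turn: "tr tilt ** rz pi ** tilt \<notin> D m" by (rule D33) (simp_all add: tilt_rz_pi)

  have "\<not> (\<exists>A\<in>Z n. tr (rz ?p ** tilt) ** (hx ** A) ** (rz ?p ** tilt) \<in> D m)"
  proof -
    have "tr tilt ** (hx ** rz (a + 2 * ?p)) ** tilt \<notin> D m" if "rz a \<in> Z n" for a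
    proof (rule D33)
      define c where "c = cos (a + 2 * ?p)"
      have "c \<noteq> 1" using sin_shifted[OF n that] sin_zero_of_cos unfolding c_def by blast
      then have c: "-1 \<le> c" "c < 1" by (simp_all add: c_def order_less_le)
      show "(tr tilt ** (hx ** rz (a + 2 * ?p)) ** tilt) $ 3 $ 3 \<noteq> 1"
        unfolding tilt_flip c_def[symmetric] using c(1) by simp
      show "(tr tilt ** (hx ** rz (a + 2 * ?p)) ** tilt) $ 3 $ 3 \<noteq> -1"
        unfolding tilt_flip c_def[symmetric] using c(2) by simp
    qed
    then show ?thesis by (metis Z_E conj_rz_mult(1))
  qed
  then have 1: "conj_class (cut m n (rz ?p ** tilt)) = conj_class (Z 1)"
    using conj_class_cut_axis_moved[OF orth(1) moved(2) m n, of ?p] tilt_half_turn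
    by (simp add: conj_rz_mult(2))

  have "\<not> (\<exists>A\<in>Z n. tr (rz ?p ** swap13) ** (hx ** A) ** (rz ?p ** swap13) \<in> D m)"
  proof -
    have "swap13 ** (hx ** rz (a + 2 * ?p)) ** swap13 \<notin> D m" if "rz a \<in> Z n" for a
      by (rule D33) (use sin_shifted[OF n that] sin_zero_of_cos in \<open>auto simp only: swap13_flip\<close>)
    then show ?thesis by (metis Z_E conj_rz_mult(1) tr_swap13)
  qed
  moreover have "tr (rz ?p ** swap13) ** rz pi ** (rz ?p ** swap13) \<in> D m"
    unfolding conj_rz_mult(2) tr_swap13 swap13_rz_pi by (rule hxD)
  ultimately have 2: "conj_class (cut m n (rz ?p ** swap13)) = conj_class (Z (gcd 2 n))"
    using conj_class_cut_axis_moved[OF orth(2) moved(3) m n, of ?p] by (simp only: if_True if_False)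

  have "tr (rz ?q) ** (hx ** rz a) ** rz ?q = hx ** rz (a + 2 * ?q)" for a
    using conj_rz_mult(1)[of ?q "mat 1" a] by simp
  then have "\<not> (\<exists>A\<in>Z n. tr (rz ?q) ** (hx ** A) ** rz ?q \<in> D m)"
    using reflections_disjoint[OF m n] by (metis Z_E)
  then have 3: "conj_class (cut m n (rz ?q)) = conj_class (Z (gcd m n))"
    using conj_class_cut_axis_kept[OF orthogonal_rz _ m n, of ?q] by (simp only: if_False rz_entries power_one simp_thms)

  have "\<exists>A\<in>Z n. tr tilt ** (hx ** A) ** tilt \<in> D m"
    using hxD by (intro bexI[OF _ Z_one[OF n]]) (simp add: tilt_hx)
  then have 4: "conj_class (cut m n tilt) = conj_class (Dz 1)"
    using conj_class_cut_axis_moved[OF orthogonal_tilt moved(1) m n] tilt_half_turn by simp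

  have "\<exists>A\<in>Z n. tr (mat 1) ** (hx ** A) ** mat 1 \<in> D m"
    using hxD by (intro bexI[OF _ Z_one[OF n]]) simp
  then have 5: "conj_class (cut m n (mat 1)) = conj_class (Dz (gcd m n))"
    using conj_class_cut_axis_kept[OF orthogonal_matrix_id _ m n] by (simp add: mat1_entries)

  show thesis
    by (rule that[OF orth(1) 1 orth(2) 2 orthogonal_rz 3 orthogonal_tilt 4 orthogonal_matrix_id 5])
qed

text \<open>For even \<open>m\<close> the half-turn about \<open>e3\<close> lies in \<open>D m\<close>, and exchanging \<open>e1\<close> and \<open>e3\<close> makes it
  the half-turn belonging to the reflection \<open>- hx\<close>.\<close>

lemma clip_witness_even:
  assumes m: "m \<ge> 1" "even m" and n: "n \<ge> 1"
  shows "conj_class (cut m n swap13) = conj_class (Dz (gcd 2 n))"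
proof -
  have "\<exists>A\<in>Z n. tr swap13 ** (hx ** A) ** swap13 \<in> D m"
    using m rz_pi_in_Z_iff[OF m(1)] D_iff[OF m(1)]
    by (intro bexI[OF _ Z_one[OF n]]) (simp add: tr_swap13 swap13_hx)
  moreover have "tr swap13 ** rz pi ** swap13 \<in> D m"
    using D_iff[OF m(1)] Z_one[OF m(1)] by (simp add: tr_swap13 swap13_rz_pi hx_hx)
  ultimately show ?thesis
    using conj_class_cut_axis_moved[OF orthogonal_swap13 _ m(1) n] by (simp add: swap13_entries)
qed

theorem lemma4p8:
  fixes m n :: nat
  assumes "m \<ge> 2" and "n \<ge> 2"
  shows "clips (conj_class (Dz n)) (conj_class (plus_Z2c (D m))) =
    (if even m then
       {conj_class triv, conj_class (Z (gcd 2 n)), conj_class (Z (gcd m n)),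
        conj_class Z2_minus, conj_class (Dz (gcd 2 n)), conj_class (Dz (gcd m n))}
     else
       {conj_class triv, conj_class (Z (gcd 2 n)), conj_class (Z (gcd m n)),
        conj_class Z2_minus, conj_class (Dz (gcd m n))})"
proof -
  have mn: "m \<ge> 1" "n \<ge> 1" using assms by auto
  have conventions: "triv = Z 1" "Z2_minus = Dz 1" by (simp_all only: Z_1) (simp add: Dz_def)
  let ?C = "{conj_class (cut m n g) | g. orthogonal_matrix g}"
  let ?S = "{conj_class (Z 1), conj_class (Z (gcd 2 n)), conj_class (Z (gcd m n)),
       conj_class (Dz 1), conj_class (Dz (gcd m n))}"
  have "?S \<subseteq> ?C" using clip_witnesses[OF mn] by (smt (verit) empty_subsetI insert_subset mem_Collect_eq)
  moreover have "conj_class (Dz (gcd 2 n)) \<in> ?C" if "even m"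
    using clip_witness_even[OF mn(1) that mn(2)] orthogonal_swap13 by blast
  moreover have "c \<in> ?S \<or> even m \<and> c = conj_class (Dz (gcd 2 n))" if "c \<in> ?C" for c
    using that clip_cases[OF _ mn] by blast
  ultimately have "?C = (if even m then insert (conj_class (Dz (gcd 2 n))) ?S else ?S)" by auto
  then show ?thesis
    unfolding clips_eq_range[OF assms(2) mn(1)] conventions by (simp add: insert_commute)
qed

end
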